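(* Let $\mathcal{X}$ be a cell complex and $f\colon(\mathcal{X},\leq)\to\mathsf{P}$ an order-preserving map, where $(\mathcal{X},\leq)$ is the face poset of $\mathcal{X}$ and $\mathsf{P}$ is a poset. Suppose that for each $p\in\mathsf{P}$ there is an $n=n_p$ such that the fiber $\mathcal{X}^p=f^{-1}(p)$ is embeddable into the hypercube complex $\mathcal{H}_{n_p}$, via an incidence embedding $\iota_p\colon\mathcal{X}^p\to\mathcal{H}_{n_p}$. Let $\boldsymbol{\alpha}_p=(\alpha_{p,1},\ldots,\alpha_{p,n_p})$ where $\alpha_{p,i}\colon\mathcal{X}^p\to\mathcal{X}^p$ is defined by $$\alpha_{p,i}(\xi)=\begin{cases}\iota_p^{-1}(\mathcal{M}_i(\iota_p(\xi))) & \text{if } \mathcal{M}_i(\iota_p(\xi))\in\iota_p(\mathcal{X}^p),\\ \xi & \text{otherwise.}\end{cases}$$ Then the function $w\colon\mathcal{X}\to\mathcal{X}$ defined by $$w(\xi)=\mathrm{Mate}(\xi,\boldsymbol{\alpha}_p)\quad\text{if and only if}\quad \xi\in\mathcal{X}^p$$ is an acyclic partial matching on $\mathcal{X}$.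
   Context: **Cell complex.** Let $\mathbb{K}$ be a field. A cell complex (over $\mathbb{K}$) $(\mathcal{X},\leq,\kappa,\dim)$ is a finite poset $(\mathcal{X},\leq)$ (its face poset) together with functions $\dim\colon\mathcal{X}\to\mathbb{N}$ and $\kappa\colon\mathcal{X}\times\mathcal{X}\to\mathbb{K}$ such that: (1) $\xi\leq\xi'$ implies $\dim\xi\leq\dim\xi'$; (2) $\kappa(\xi,\xi')\neq 0$ implies $\xi'\leq\xi$ and $\dim\xi=\dim\xi'+1$; (3) for all $\xi,\xi''\in\mathcal{X}$, $\sum_{\xi'\in\mathcal{X}}\kappa(\xi,\xi')\kappa(\xi',\xi'')=0$. The incidence relation $\prec$ on $\mathcal{X}$ is: $\xi'\prec\xi$ iff $\kappa(\xi,\xi')\neq 0$. Each fiber $\mathcal{X}^p$ of an order-preserving map $f\colon(\mathcal{X},\leq)\to\mathsf{P}$ is regarded as a cell complex with the restrictions of $\leq,\kappa,\dim$. **Incidence embedding.** For cell complexes $\mathcal{X},\mathcal{X}'$ (possibly over different fields), an incidence embedding $\iota\colon\mathcal{X}\to\mathcal{X}'$ is an injective map such that for all $\xi,\xi'\in\mathcal{X}$: $\xi'\prec\xi$ iff $\iota(\xi')\prec\iota(\xi)$. If one exists, $\mathcal{X}$ is said to be embeddable into $\mathcal{X}'$. **Hypercube complex.** For $n\geq1$, $\mathcal{H}_n$ is the cell complex over $\mathbb{Z}_2$ with set of cells $\mathbb{Z}_2^n=\{0,1\}^n$, product partial order ($\mathbf{x}'\leq\mathbf{x}$ iff $x'_i\leq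 x_i$ for all $i$, with $0\leq1$), $\dim(\mathbf{x})=\sum_i x_i$ (integer sum), and $\kappa(\mathbf{x},\mathbf{x}')=1$ if $\mathbf{x}'\leq\mathbf{x}$ and $\dim\mathbf{x}'=\dim\mathbf{x}-1$, and $\kappa(\mathbf{x},\mathbf{x}')=0$ otherwise. For $1\leq i\leq n$ the template $\mathcal{M}_i\colon\mathcal{H}_n\to\mathcal{H}_n$ is $\mathcal{M}_i(\mathbf{x})=\mathbf{x}+\mathbf{e}_i$ (addition mod 2), where $\mathbf{e}_i$ is the $i$-th standard unit vector; i.e. $\mathcal{M}_i$ flips the $i$-th bit. **(Acyclic) partial matching.** A partial matching of $\mathcal{X}$ is an involution $w\colon\mathcal{X}\to\mathcal{X}$ such that for every $\xi$: $w(\xi)=\xi$, or $\xi\prec w(\xi)$, or $w(\xi)\prec\xi$. Put $Q(w)=\{\xi\mid\xi\prec w(\xi)\}$ and, for $\xi_0,\xi_1\in Q(w)$, let $\xi_1\ll\xi_0$ iff $\xi_1\prec w(\xi_0)$. The partial matching $w$ is acyclic if the transitive closure of $\ll$ is a partial order on $Q(w)$. **The algorithm Mate.** For a sequence $\mathbf{w}=(w_1,\ldots,w_n)$ of partial matchings on a cell complex, $\mathrm{Mate}(\xi,\mathbf{w})$ returns $\mathrm{MateHelper}(\xi,n,\mathbf{w})$, where $\mathrm{MateHelper}(\xi,i,\mathbf{w})$ is the recursive procedure: - if $i=0$, return $\xi$; - otherwise set $\xi':=\mathrm{MateHelper}(\xi,i-1,\mathbf{w})$; - if $\xi'=\xi$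 and $\mathrm{MateHelper}(w_i(\xi),i-1,\mathbf{w})=w_i(\xi)$, return $w_i(\xi)$; - otherwise return $\xi'$. (For each $p$, every $\alpha_{p,i}$ is a partial matching on $\mathcal{X}^p$, so $\mathrm{Mate}(\cdot,\boldsymbol{\alpha}_p)$ is applied on the cell complex $\mathcal{X}^p$.) *)

theory Defs
  imports "HOL-Library.Z2" "HOL-Library.FuncSet"
begin

record ('a, 'k) cell_cx =
  cells :: "'a set"
  face :: "'a rel"  \<comment> \<open>\<^term>\<open>(x', x) \<in> face X\<close> means \<open>x' \<le> x\<close>\<close>
  kappa :: "'a \<Rightarrow> 'a \<Rightarrow> 'k"
  cdim :: "'a \<Rightarrow> nat"

definition cell_complex :: "('a, 'k::field) cell_cx \<Rightarrow> bool" where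
  "cell_complex X \<longleftrightarrow>
     finite (cells X) \<and>
     partial_order_on (cells X) (face X) \<and>
     (\<forall>x\<in>cells X. \<forall>y\<in>cells X. (x, y) \<in> face X \<longrightarrow> cdim X x \<le> cdim X y) \<and>
     (\<forall>x\<in>cells X. \<forall>y\<in>cells X. kappa X x y \<noteq> 0 \<longrightarrow>
        (y, x) \<in> face X \<and> cdim X x = cdim X y + 1) \<and>
     (\<forall>x\<in>cells X. \<forall>z\<in>cells X. (\<Sum>y\<in>cells X. kappa X x y * kappa X y z) = 0)"

text \<open>\<open>prec X y x\<close> is \<open>y \<prec> x\<close>; note the order of the arguments of \<open>kappa\<close>.\<close>

definition prec :: "('a, 'k::field) cell_cx \<Rightarrow> 'a \<Rightarrow> 'a \<Rightarrow> bool" where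
  "prec X y x \<longleftrightarrow> x \<in> cells X \<and> y \<in> cells X \<and> kappa X x y \<noteq> 0"

definition order_preserving :: "('a, 'k::field) cell_cx \<Rightarrow> ('a \<Rightarrow> 'p::order) \<Rightarrow> bool" where
  "order_preserving X f \<longleftrightarrow> monotone_on (cells X) (\<lambda>x y. (x, y) \<in> face X) (\<le>) f"

text \<open>The values of \<open>kappa\<close> and \<open>cdim\<close> outside \<open>cells\<close> are never used, so only
  \<open>cells\<close> and \<open>face\<close> have to be restricted.\<close>

definition fiber :: "('a, 'k::field) cell_cx \<Rightarrow> ('a \<Rightarrow> 'p) \<Rightarrow> 'p \<Rightarrow> ('a, 'k) cell_cx" where
  "fiber X f p =
     (let F = {x \<in> cells X. f x = p}
      in \<lparr>cells = F, face = Restr (face X) F, kappa = kappa X, cdim = cdim X\<rparr>)"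

definition incidence_embedding ::
  "('a, 'k::field) cell_cx \<Rightarrow> ('b, 'l::field) cell_cx \<Rightarrow> ('a \<Rightarrow> 'b) \<Rightarrow> bool" where
  "incidence_embedding X Y \<iota> \<longleftrightarrow>
     \<iota> \<in> cells X \<rightarrow> cells Y \<and> inj_on \<iota> (cells X) \<and>
     (\<forall>x\<in>cells X. \<forall>y\<in>cells X. prec X y x \<longleftrightarrow> prec Y (\<iota> y) (\<iota> x))"

text \<open>Vectors in \<open>\<int>\<^sub>2\<^sup>n\<close> are the functions \<open>nat \<Rightarrow> bit\<close> extensional on the index set
  \<open>{1..n}\<close>.  The type \<open>bit\<close> carries no order; \<open>of_bit\<close> maps \<open>0, 1\<close> to the naturals \<open>0, 1\<close>.\<close>

definition cube_dim :: "nat \<Rightarrow> (nat \<Rightarrow> bit) \<Rightarrow> nat" where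
  "cube_dim n x = (\<Sum>i\<in>{1..n}. of_bit (x i))"

definition cube_le :: "nat \<Rightarrow> (nat \<Rightarrow> bit) \<Rightarrow> (nat \<Rightarrow> bit) \<Rightarrow> bool" where
  "cube_le n x' x \<longleftrightarrow> (\<forall>i\<in>{1..n}. (of_bit (x' i) :: nat) \<le> of_bit (x i))"

definition hypercube :: "nat \<Rightarrow> (nat \<Rightarrow> bit, bit) cell_cx" where
  "hypercube n =
     (let V = {1..n} \<rightarrow>\<^sub>E (UNIV :: bit set)
      in \<lparr>cells = V,
          face = {(x', x) \<in> V \<times> V. cube_le n x' x},
          kappa = (\<lambda>x x'. if cube_le n x' x \<and> cube_dim n x' + 1 = cube_dim n x then 1 else 0),
          cdim = cube_dim n\<rparr>)"

definition template :: "nat \<Rightarrow> nat \<Rightarrow> (nat \<Rightarrow> bit) \<Rightarrow> (nat \<Rightarrow> bit)" where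
  "template n i x = (\<lambda>j\<in>{1..n}. x j + (if j = i then 1 else 0))"

definition partial_matching :: "('a, 'k::field) cell_cx \<Rightarrow> ('a \<Rightarrow> 'a) \<Rightarrow> bool" where
  "partial_matching X w \<longleftrightarrow>
     w \<in> cells X \<rightarrow> cells X \<and>
     (\<forall>x\<in>cells X. w (w x) = x) \<and>
     (\<forall>x\<in>cells X. w x = x \<or> prec X x (w x) \<or> prec X (w x) x)"

definition matching_Q :: "('a, 'k::field) cell_cx \<Rightarrow> ('a \<Rightarrow> 'a) \<Rightarrow> 'a set" where
  "matching_Q X w = {x \<in> cells X. prec X x (w x)}"

definition matching_rel :: "('a, 'k::field) cell_cx \<Rightarrow> ('a \<Rightarrow> 'a) \<Rightarrow> 'a rel" where
  "matching_rel X w =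
     {(x1, x0). x1 \<in> matching_Q X w \<and> x0 \<in> matching_Q X w \<and> prec X x1 (w x0)}"

definition acyclic_partial_matching :: "('a, 'k::field) cell_cx \<Rightarrow> ('a \<Rightarrow> 'a) \<Rightarrow> bool" where
  "acyclic_partial_matching X w \<longleftrightarrow>
     partial_matching X w \<and> partial_order_on (matching_Q X w) ((matching_rel X w)\<^sup>+)"

text \<open>The sequence \<open>(w\<^sub>1, \<dots>, w\<^sub>n)\<close> is the list \<open>ws\<close> of length \<open>n\<close>, so that \<open>w\<^sub>i\<close> is
  \<open>ws ! (i - 1)\<close>.\<close>

fun mate_helper :: "'a \<Rightarrow> nat \<Rightarrow> ('a \<Rightarrow> 'a) list \<Rightarrow> 'a" where
  "mate_helper x 0 ws = x"
| "mate_helper x (Suc i) ws =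
     (let x' = mate_helper x i ws; w = ws ! i
      in if x' = x \<and> mate_helper (w x) i ws = w x then w x else x')"

definition mate :: "'a \<Rightarrow> ('a \<Rightarrow> 'a) list \<Rightarrow> 'a" where
  "mate x ws = mate_helper x (length ws) ws"

definition alpha ::
  "('a, 'k::field) cell_cx \<Rightarrow> nat \<Rightarrow> ('a \<Rightarrow> nat \<Rightarrow> bit) \<Rightarrow> nat \<Rightarrow> 'a \<Rightarrow> 'a" where
  "alpha C n \<iota> i x =
     (if template n i (\<iota> x) \<in> \<iota> ` cells C
      then inv_into (cells C) \<iota> (template n i (\<iota> x)) else x)"

definition alpha_seq ::
  "('a, 'k::field) cell_cx \<Rightarrow> nat \<Rightarrow> ('a \<Rightarrow> nat \<Rightarrow> bit) \<Rightarrow> ('a \<Rightarrow> 'a) list" where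
  "alpha_seq C n \<iota> = map (alpha C n \<iota>) [1..<Suc n]"

end

theory Submission
  imports Defs
begin

text \<open>
  Two independent ideas carry the proof.

  \<^emph>\<open>Patching.\<close>  If \<open>x1 \<lless> x0\<close> then \<open>x1\<close> is a face of \<open>w x0\<close>, and \<open>w\<close> preserves fibers, so \<open>f\<close>
  cannot increase from \<open>x0\<close> to \<open>x1\<close>.  Hence a \<open>\<lless>\<close>-cycle lives in a single fiber, and a matching
  that is acyclic on every fiber is acyclic (\<open>acyclic_partial_matching_patchwork\<close>).

  \<^emph>\<open>A single fiber.\<close>  View the fiber as a set of vertices of the cube.  The procedure Mate matches
  greedily: it runs through the bits \<open>1, 2, \<dots>\<close>, and at bit \<open>i\<close> it matches along that bit all pairs
  of vertices that are still free.  Call the bit along which a vertex is matched its stage.  A step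
  from \<open>x0\<close> to some \<open>x1 \<lless> x0\<close> sets bit \<open>i\<close>, the stage of \<open>x0\<close>, and then clears a bit \<open>j\<close>; if
  \<open>x1 \<noteq> x0\<close> then \<open>i \<noteq> j\<close>.  Suppose \<open>j < i\<close>.  At stage \<open>j\<close> the vertex \<open>w x0\<close> was still free and yet
  was not matched with its neighbour \<open>x1\<close>, so \<open>x1\<close> had been matched before: its stage is less than
  \<open>j\<close> (\<open>stage_less_of_skipped\<close>).  Now let \<open>m\<close> be the least bit that changes along a cycle.  Some step
  of the cycle clears \<open>m\<close>; that step sets a bit greater than \<open>m\<close>, so the next step sets a bit less
  than \<open>m\<close>, which contradicts the choice of \<open>m\<close>.  The formal proof replaces the cycle by an invariant
  of paths, \<open>descends\<close>, which records the least changed bit and never relates a vertex to itself.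
\<close>

section \<open>The matching produced by Mate\<close>

lemma mate_helper_mono:
  assumes "mate_helper x i ws \<noteq> x" "i \<le> j"
  shows "mate_helper x j ws = mate_helper x i ws"
  using assms(2)
proof (induction j rule: dec_induct)
  case (step j)
  then show ?case using assms(1) by (simp add: Let_def)
qed simp

lemma mate_helper_closed:
  assumes "\<And>v. v \<in> set ws \<Longrightarrow> v \<in> C \<rightarrow> C" "i \<le> length ws" "x \<in> C"
  shows "mate_helper x i ws \<in> C"
  using assms(2)
proof (induction i)
  case (Suc i)
  moreover have "(ws ! i) x \<in> C"
    using assms(1)[of "ws ! i"] Suc.prems assms(3) by auto
  ultimately show ?case by (simp add: Let_def)
qed (simp add: assms)

text \<open>A cell that is matched at an earlier step keeps its mate, so only cells free at step \<open>i\<close>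
  matter, and for these the test in the procedure is symmetric in the cell and its image.\<close>

lemma mate_helper_involutive:
  assumes "\<And>v x. v \<in> set ws \<Longrightarrow> x \<in> C \<Longrightarrow> v (v x) = x"
    and "i \<le> length ws" "x \<in> C"
  shows "mate_helper (mate_helper x i ws) i ws = x"
  using assms(2)
proof (induction i)
  case (Suc i)
  then have IH: "mate_helper (mate_helper x i ws) i ws = x" by simp
  have inv: "(ws ! i) ((ws ! i) x) = x"
    using assms(1,3) Suc.prems by simp
  show ?case
  proof (cases "mate_helper x i ws = x")
    case True
    then show ?thesis using inv by (simp add: Let_def)
  next
    case False
    then show ?thesis using IH by (simp add: Let_def)
  qed
qed simp

text \<open>Stages are counted from 1, in line with the numbering of the bits: at stage \<open>i\<close> the matching
  \<open>ws ! (i - 1)\<close> is used.  The value is meaningful only for a cell that gets matched.\<close>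

definition stage :: "('a \<Rightarrow> 'a) list \<Rightarrow> 'a \<Rightarrow> nat" where
  "stage ws x = (LEAST i. mate_helper x i ws \<noteq> x)"

lemma stage_le: "mate_helper x i ws \<noteq> x \<Longrightarrow> stage ws x \<le> i"
  unfolding stage_def by (rule Least_le)

lemma unmatched_before_stage: "i < stage ws x \<Longrightarrow> mate_helper x i ws = x"
  using stage_le by fastforce

lemma stage_props:
  assumes "mate x ws \<noteq> x"
  shows "stage ws x \<in> {1..length ws}"
    and "mate x ws = (ws ! (stage ws x - 1)) x"
proof -
  let ?s = "stage ws x"
  have neq: "mate_helper x ?s ws \<noteq> x"
    unfolding stage_def using assms unfolding mate_def by (rule LeastI)
  then obtain k where k: "?s = Suc k"
    by (cases ?s) auto
  have le: "?s \<le> length ws"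
    using assms unfolding mate_def by (rule stage_le)
  then show "?s \<in> {1..length ws}" using k by simp
  have "mate_helper x k ws = x"
    by (rule unmatched_before_stage) (simp add: k)
  then have "mate_helper x ?s ws = (ws ! k) x"
    using neq unfolding k by (simp add: Let_def split: if_splits)
  then show "mate x ws = (ws ! (?s - 1)) x"
    using mate_helper_mono[OF neq le] k by (simp add: mate_def)
qed

lemma partial_matching_mate:
  fixes X :: "('a, 'k::field) cell_cx"
  assumes "\<And>v. v \<in> set ws \<Longrightarrow> partial_matching X v"
  shows "partial_matching X (\<lambda>x. mate x ws)"
  unfolding partial_matching_def
proof (intro conjI ballI)
  show "(\<lambda>x. mate x ws) \<in> cells X \<rightarrow> cells X"
    using mate_helper_closed[of ws "cells X"] assms
    unfolding mate_def partial_matching_def by blast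
next
  fix x assume x: "x \<in> cells X"
  show "mate (mate x ws) ws = x"
    unfolding mate_def
    by (rule mate_helper_involutive[of _ "cells X"])
      (use assms x in \<open>auto simp: partial_matching_def\<close>)
  show "mate x ws = x \<or> prec X x (mate x ws) \<or> prec X (mate x ws) x"
  proof (cases "mate x ws = x")
    case False
    have "ws ! (stage ws x - 1) \<in> set ws"
      using stage_props(1)[OF False] by (intro nth_mem) auto
    then show ?thesis
      using assms x stage_props(2)[OF False] unfolding partial_matching_def by metis
  qed simp
qed

lemma stage_mate:
  fixes X :: "('a, 'k::field) cell_cx"
  assumes pm: "\<And>v. v \<in> set ws \<Longrightarrow> partial_matching X v"
    and x: "x \<in> cells X" and neq: "mate x ws \<noteq> x"
  shows "stage ws (mate x ws) = stage ws x"
proof -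
  have le: "stage ws (mate y ws) \<le> stage ws y"
    if y: "y \<in> cells X" "mate y ws \<noteq> y" for y
  proof (rule stage_le)
    let ?s = "stage ws y"
    have s: "mate_helper y ?s ws \<noteq> y"
      unfolding stage_def using y(2) unfolding mate_def by (rule LeastI)
    have l: "?s \<le> length ws" using stage_props(1)[OF y(2)] by simp
    have "mate y ws = mate_helper y ?s ws"
      using mate_helper_mono[OF s l] by (simp add: mate_def)
    moreover have "mate_helper (mate_helper y ?s ws) ?s ws = y"
      by (rule mate_helper_involutive[of _ "cells X"])
        (use pm y l in \<open>auto simp: partial_matching_def\<close>)
    ultimately show "mate_helper (mate y ws) ?s ws \<noteq> mate y ws"
      using y(2) by simp
  qed
  have "mate x ws \<in> cells X" "mate (mate x ws) ws = x"
    using partial_matching_mate[OF pm] x unfolding partial_matching_def by auto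
  then show ?thesis using le[of x] le[of "mate x ws"] x neq by simp
qed

text \<open>The greedy choice: a free cell \<open>z\<close> passes over its neighbour at step \<open>j\<close> only because that
  neighbour is no longer free.\<close>

lemma stage_less_of_skipped:
  assumes "1 \<le> j" "j < stage ws z" "(ws ! (j - 1)) z \<noteq> z"
  shows "stage ws ((ws ! (j - 1)) z) < j"
proof -
  obtain k where k: "j = Suc k" using assms(1) by (cases j) auto
  have "mate_helper z k ws = z"
    by (rule unmatched_before_stage) (use assms(2) k in simp)
  moreover have "mate_helper z j ws = z"
    by (rule unmatched_before_stage) (fact assms(2))
  ultimately have "mate_helper ((ws ! k) z) k ws \<noteq> (ws ! k) z"
    using assms(3) by (auto simp: k Let_def)
  then show ?thesis using stage_le[of "(ws ! k) z" k ws] k by simp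
qed

section \<open>Incidence in the hypercube\<close>

lemma cells_hypercube: "cells (hypercube n) = {1..n} \<rightarrow>\<^sub>E UNIV"
  by (simp add: hypercube_def Let_def)

lemma template_apply:
  "x \<in> cells (hypercube n) \<Longrightarrow> i \<in> {1..n} \<Longrightarrow>
     template n i x j = (if j = i then x j + 1 else x j)"
  by (auto simp: template_def cells_hypercube PiE_def extensional_def)

lemma template_cells: "template n i x \<in> cells (hypercube n)"
  by (simp add: template_def cells_hypercube)

lemma template_involutive:
  "x \<in> cells (hypercube n) \<Longrightarrow> i \<in> {1..n} \<Longrightarrow> template n i (template n i x) = x"
  using template_cells[of n i x] by (auto simp: fun_eq_iff template_apply)

lemma cube_dim_template:
  assumes "x \<in> cells (hypercube n)" "i \<in> {1..n}" "x i = 1"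
  shows "cube_dim n (template n i x) + 1 = cube_dim n x"
proof -
  have "(\<Sum>j\<in>{1..n} - {i}. of_bit (template n i x j)) = (\<Sum>j\<in>{1..n} - {i}. of_bit (x j) :: nat)"
    using assms by (intro sum.cong) (auto simp: template_apply)
  moreover have "(\<Sum>j\<in>{1..n}. of_bit (y j) :: nat)
      = of_bit (y i) + (\<Sum>j\<in>{1..n} - {i}. of_bit (y j))" for y
    using assms(2) by (intro sum.remove) auto
  ultimately show ?thesis
    unfolding cube_dim_def using assms by (simp add: template_apply)
qed

text \<open>If \<open>y \<le> x\<close> then the dimensions differ by the number of bits at which \<open>x\<close> and \<open>y\<close> differ, so
  consecutive dimensions force a single differing bit.\<close>

lemma prec_hypercube_iff:
  "prec (hypercube n) y x \<longleftrightarrow>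
     x \<in> cells (hypercube n) \<and> (\<exists>i\<in>{1..n}. x i = 1 \<and> y = template n i x)"
  (is "?L \<longleftrightarrow> ?R")
proof
  assume ?R
  then obtain i where i: "x \<in> cells (hypercube n)" "i \<in> {1..n}" "x i = 1" "y = template n i x"
    by blast
  have "cube_le n y x"
    unfolding cube_le_def using i by (simp add: template_apply)
  then show ?L
    using i cube_dim_template[OF i(1-3)] template_cells[of n i x]
    by (simp add: prec_def hypercube_def Let_def)
next
  assume ?L
  then have x: "x \<in> cells (hypercube n)" and y: "y \<in> cells (hypercube n)"
    and le: "cube_le n y x" and dim: "cube_dim n y + 1 = cube_dim n x"
    by (auto simp: prec_def hypercube_def Let_def split: if_splits)
  have bit_le: "of_bit (y j) \<le> (of_bit (x j) :: nat)" if "j \<in> {1..n}" for j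
    using le that by (simp add: cube_le_def)
  define D where "D = {j \<in> {1..n}. y j \<noteq> x j}"
  have D: "x j = 1 \<and> y j = 0" if "j \<in> D" for j
    using that bit_le[of j] unfolding D_def by (cases "x j"; cases "y j") auto
  have "cube_dim n x = cube_dim n y + (\<Sum>j\<in>{1..n}. of_bit (x j) - of_bit (y j))"
    unfolding cube_dim_def sum.distrib[symmetric]
    by (intro sum.cong refl) (rule le_add_diff_inverse[OF bit_le, symmetric])
  also have "(\<Sum>j\<in>{1..n}. of_bit (x j) - of_bit (y j) :: nat) = (\<Sum>j\<in>D. 1)"
  proof (rule sum.mono_neutral_cong_right)
    show "of_bit (x j) - of_bit (y j) = (1 :: nat)" if "j \<in> D" for j
      using D[OF that] by simp
  qed (auto simp: D_def)
  finally have "card D = 1" using dim by simp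
  then obtain i where i: "D = {i}" by (rule card_1_singletonE)
  then have iD: "i \<in> {1..n}" "x i = 1" "y i = 0" using D[of i] by (auto simp: D_def)
  have "y j = template n i x j" for j
  proof (cases "j \<in> {1..n}")
    case True
    then have "y j = x j \<longleftrightarrow> j \<noteq> i" using i by (auto simp: D_def)
    then show ?thesis using iD x by (auto simp: template_apply)
  next
    case False
    then have "y j = undefined" using y by (auto simp: cells_hypercube)
    then show ?thesis by (simp only: template_def restrict_apply False if_False)
  qed
  then have "y = template n i x" by (rule ext)
  then show ?R using x iD by blast
qed

section \<open>Acyclicity on an embedded fiber\<close>

lemma alpha_image:
  "alpha C n \<iota> i x = x \<or>
    alpha C n \<iota> i x \<in> cells C \<and> \<iota> (alpha C n \<iota> i x) = template n i (\<iota> x)"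
proof (cases "template n i (\<iota> x) \<in> \<iota> ` cells C")
  case True
  then show ?thesis
    unfolding alpha_def using inv_into_into[OF True] f_inv_into_f[OF True] by simp
qed (simp add: alpha_def)

lemma alpha_eqI:
  assumes "incidence_embedding C (hypercube n) \<iota>" "y \<in> cells C" "\<iota> y = template n i (\<iota> x)"
  shows "alpha C n \<iota> i x = y"
  using assms unfolding alpha_def incidence_embedding_def by (metis image_eqI inv_into_f_f)

lemma partial_matching_alpha:
  fixes C :: "('a, 'k::field) cell_cx"
  assumes emb: "incidence_embedding C (hypercube n) \<iota>" and i: "i \<in> {1..n}"
  shows "partial_matching C (alpha C n \<iota> i)"
  unfolding partial_matching_def
proof (intro conjI ballI)
  show "alpha C n \<iota> i \<in> cells C \<rightarrow> cells C"
  proof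
    show "alpha C n \<iota> i x \<in> cells C" if "x \<in> cells C" for x
      using alpha_image[of C n \<iota> i x] that by auto
  qed
next
  fix x assume x: "x \<in> cells C"
  let ?y = "alpha C n \<iota> i x"
  have cube: "\<iota> x \<in> cells (hypercube n)" and iff: "\<And>u v. u \<in> cells C \<Longrightarrow> v \<in> cells C \<Longrightarrow>
      prec C v u \<longleftrightarrow> prec (hypercube n) (\<iota> v) (\<iota> u)"
    using emb x unfolding incidence_embedding_def by auto
  have y: "?y = x \<or> ?y \<in> cells C \<and> \<iota> ?y = template n i (\<iota> x)"
    by (rule alpha_image)
  show "alpha C n \<iota> i ?y = x"
  proof (cases "?y = x")
    case False
    then have "\<iota> x = template n i (\<iota> ?y)"
      using y cube i by (simp add: template_involutive)
    then show ?thesis by (rule alpha_eqI[OF emb x])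
  qed simp
  show "?y = x \<or> prec C x ?y \<or> prec C ?y x"
  proof (cases "?y = x")
    case False
    then have yC: "?y \<in> cells C" and \<iota>y: "\<iota> ?y = template n i (\<iota> x)" using y by auto
    show ?thesis
    proof (cases "\<iota> x i = 1")
      case True
      then have "prec (hypercube n) (\<iota> ?y) (\<iota> x)"
        using cube i \<iota>y by (auto simp: prec_hypercube_iff)
      then show ?thesis using iff x yC by simp
    next
      case False
      then have "\<iota> ?y i = 1" using cube i \<iota>y by (simp add: template_apply)
      moreover have "\<iota> x = template n i (\<iota> ?y)"
        using cube i \<iota>y by (simp add: template_involutive)
      ultimately have "prec (hypercube n) (\<iota> x) (\<iota> ?y)"
        unfolding prec_hypercube_iff using i \<iota>y template_cells by metis
      then show ?thesis using iff x yC by simp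
    qed
  qed simp
qed

lemma alpha_seq_nth:
  "i \<in> {1..n} \<Longrightarrow> alpha_seq C n \<iota> ! (i - 1) = alpha C n \<iota> i"
  by (auto simp: alpha_seq_def simp del: upt_Suc)

lemma set_alpha_seq: "set (alpha_seq C n \<iota>) = alpha C n \<iota> ` {1..n}"
  by (auto simp: alpha_seq_def atLeastLessThanSuc_atLeastAtMost simp del: upt_Suc)

lemma length_alpha_seq: "length (alpha_seq C n \<iota>) = n"
  by (simp add: alpha_seq_def)

text \<open>One step of a \<open>\<lless>\<close>-path, in coordinates: bit \<open>i\<close> is set and bit \<open>j\<close> is cleared.\<close>

lemma matching_step_bits:
  fixes C :: "('a, 'k::field) cell_cx"
  assumes emb: "incidence_embedding C (hypercube n) \<iota>"
    and step: "(y, x) \<in> matching_rel C (\<lambda>x. mate x (alpha_seq C n \<iota>))" and neq: "y \<noteq> x"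
  obtains j where "j \<noteq> stage (alpha_seq C n \<iota>) x"
    and "\<iota> x (stage (alpha_seq C n \<iota>) x) = 0"
    and "\<And>k. \<iota> y k = (if k = j then 0 else if k = stage (alpha_seq C n \<iota>) x then 1 else \<iota> x k)"
    and "j < stage (alpha_seq C n \<iota>) x \<Longrightarrow> stage (alpha_seq C n \<iota>) y < j"
proof -
  let ?ws = "alpha_seq C n \<iota>"
  let ?i = "stage ?ws x" and ?z = "mate x ?ws"
  have pm: "partial_matching C v" if "v \<in> set ?ws" for v
    using that partial_matching_alpha[OF emb] by (auto simp: set_alpha_seq)
  have x: "x \<in> cells C" and y: "y \<in> cells C" and up: "prec C x ?z" and down: "prec C y ?z"
    using step by (auto simp: matching_rel_def matching_Q_def)
  have z: "?z \<in> cells C" using up by (simp add: prec_def)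
  have cube: "\<iota> u \<in> cells (hypercube n)" if "u \<in> cells C" for u
    using emb that unfolding incidence_embedding_def by auto
  have iff: "prec C v u \<longleftrightarrow> prec (hypercube n) (\<iota> v) (\<iota> u)"
    if "u \<in> cells C" "v \<in> cells C" for u v
    using emb that unfolding incidence_embedding_def by auto
  have irrefl: "\<not> prec C u u" if "u \<in> cells C" for u
  proof -
    have "template n i (\<iota> u) i \<noteq> \<iota> u i" if "i \<in> {1..n}" for i
      using template_apply[OF cube[OF \<open>u \<in> cells C\<close>] that, of i] by (cases "\<iota> u i") auto
    then have "\<iota> u \<noteq> template n i (\<iota> u)" if "i \<in> {1..n}" for i
      using that by metis
    then show ?thesis using iff that by (auto simp: prec_hypercube_iff)
  qed
  have zx: "?z \<noteq> x" using up irrefl x by auto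
  have zy: "?z \<noteq> y" using down irrefl y by auto
  have i: "?i \<in> {1..n}" and zi: "?z = alpha C n \<iota> ?i x"
    using stage_props[OF zx] alpha_seq_nth[of ?i n C \<iota>] by (auto simp: length_alpha_seq)
  have \<iota>z: "\<iota> ?z = template n ?i (\<iota> x)"
    using alpha_image[of C n \<iota> ?i x] zx unfolding zi by auto
  \<comment> \<open>The bit at which \<open>x\<close> and its coface differ must be the stage, since two bits cannot flip.\<close>
  obtain i' where i': "i' \<in> {1..n}" "\<iota> ?z i' = 1" "\<iota> x = template n i' (\<iota> ?z)"
    using up iff x z by (auto simp: prec_hypercube_iff)
  have "\<iota> x i' = 0" using i' cube[OF z] by (simp add: template_apply)
  then have "i' = ?i"
    using i'(2) i cube[OF x] unfolding \<iota>z by (auto simp: template_apply split: if_splits)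
  then have x0: "\<iota> x ?i = 0" using \<open>\<iota> x i' = 0\<close> by simp
  obtain j where j: "j \<in> {1..n}" "\<iota> ?z j = 1" "\<iota> y = template n j (\<iota> ?z)"
    using down iff y z by (auto simp: prec_hypercube_iff)
  have "j \<noteq> ?i"
  proof
    assume "j = ?i"
    then have "\<iota> y = \<iota> x" using j(3) i'(3) \<open>i' = ?i\<close> by simp
    then show False using emb x y neq unfolding incidence_embedding_def by (auto dest: inj_onD)
  qed
  moreover have "\<iota> y k = (if k = j then 0 else if k = ?i then 1 else \<iota> x k)" for k
    using j cube[OF z] cube[OF x] i x0 unfolding j(3)
    by (auto simp: template_apply \<iota>z)
  moreover have "stage ?ws y < j" if "j < ?i"
  proof -
    have yj: "(?ws ! (j - 1)) ?z = y"
      using alpha_eqI[OF emb y j(3)] by (simp only: alpha_seq_nth[OF j(1)])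
    have "j < stage ?ws ?z"
      using that stage_mate[OF pm x zx] by simp
    then show ?thesis
      using stage_less_of_skipped[of j ?ws ?z] j(1) zy unfolding yj by simp
  qed
  ultimately show ?thesis using that x0 by blast
qed

text \<open>The invariant of \<open>\<lless>\<close>-paths from \<open>x\<close> down to \<open>y\<close>; \<open>b\<close> gives bits and \<open>s\<close> stages.  The witness
  \<open>m\<close> is the least bit that changes along the path.  The step that clears \<open>m\<close>, if there is one,
  must be the last step, as the stage after it is less than \<open>m\<close>; otherwise \<open>m\<close> is only ever set.
  The first step sets the bit \<open>s x\<close>, whence \<open>m \<le> s x\<close>; so \<open>y = x\<close> is impossible in both cases.\<close>

definition descends :: "('a \<Rightarrow> nat \<Rightarrow> bit) \<Rightarrow> ('a \<Rightarrow> nat) \<Rightarrow> 'a \<Rightarrow> 'a \<Rightarrow> bool" where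
  "descends b s x y \<longleftrightarrow>
     (\<exists>m. (\<forall>k<m. b x k = b y k) \<and> m \<le> s x \<and> (b x m = 0 \<and> b y m = 1 \<or> s y < m))"

lemma descends_irrefl: "\<not> descends b s x x"
  by (auto simp: descends_def)

lemma descends_step:
  assumes "j \<noteq> s x" "b x (s x) = 0"
    and bits: "\<And>k. b y k = (if k = j then 0 else if k = s x then 1 else b x k)"
    and "j < s x \<Longrightarrow> s y < j"
  shows "descends b s x y"
proof (cases "j < s x")
  case True
  then show ?thesis
    unfolding descends_def using assms by (intro exI[of _ j]) auto
next
  case False
  then show ?thesis
    unfolding descends_def using assms by (intro exI[of _ "s x"]) auto
qed

text \<open>The new least changed bit is one of the old one, the bit set, and the bit cleared.\<close>

lemma descends_extend:
  assumes xy: "descends b s x y" and "j \<noteq> s y" "b y (s y) = 0"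
    and bits: "\<And>k. b z k = (if k = j then 0 else if k = s y then 1 else b y k)"
    and skip: "j < s y \<Longrightarrow> s z < j"
  shows "descends b s x z"
proof -
  obtain m where m: "\<forall>k<m. b x k = b y k" "m \<le> s x" "b x m = 0 \<and> b y m = 1 \<or> s y < m"
    using xy by (auto simp: descends_def)
  have "s y \<noteq> m" using assms(3) m(3) by auto
  then consider "j < s y" "j \<le> m" | "s y < j" "s y < m" | "m < s y" "m < j"
    using assms(2) by linarith
  then show ?thesis
  proof cases
    case 1
    then show ?thesis
      unfolding descends_def using m bits skip by (intro exI[of _ j]) auto
  next
    case 2
    then show ?thesis
      unfolding descends_def using m bits assms(3) by (intro exI[of _ "s y"]) auto
  next
    case 3
    then show ?thesis
      unfolding descends_def using m bits by (intro exI[of _ m]) auto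
  qed
qed

lemma acyclic_partial_matchingI:
  assumes "partial_matching X w" "antisym ((matching_rel X w)\<^sup>+)"
  shows "acyclic_partial_matching X w"
proof -
  have "matching_rel X w \<subseteq> matching_Q X w \<times> matching_Q X w"
    by (auto simp: matching_rel_def)
  then have "(matching_rel X w)\<^sup>+ \<subseteq> matching_Q X w \<times> matching_Q X w"
    by (rule trancl_subset_Sigma)
  moreover have "(x, x) \<in> matching_rel X w" if "x \<in> matching_Q X w" for x
    using that by (auto simp: matching_rel_def matching_Q_def)
  ultimately show ?thesis
    using assms
    by (auto simp: acyclic_partial_matching_def partial_order_on_def preorder_on_def refl_on_def)
qed

lemma acyclic_partial_matching_mate_cube:
  fixes C :: "('a, 'k::field) cell_cx"
  assumes emb: "incidence_embedding C (hypercube n) \<iota>"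
  shows "acyclic_partial_matching C (\<lambda>x. mate x (alpha_seq C n \<iota>))"
proof (rule acyclic_partial_matchingI)
  let ?ws = "alpha_seq C n \<iota>"
  let ?R = "matching_rel C (\<lambda>x. mate x ?ws)"
  show "partial_matching C (\<lambda>x. mate x ?ws)"
    using partial_matching_alpha[OF emb] by (intro partial_matching_mate) (auto simp: set_alpha_seq)
  \<comment> \<open>Every cell of \<open>Q\<close> is \<open>\<lless>\<close>-related to itself, so the invariant concerns the other steps only.\<close>
  have path: "descends \<iota> (stage ?ws) x y" if "(y, x) \<in> (?R - Id)\<^sup>+" for x y
    using that
  proof (induction rule: converse_trancl_induct)
    case (base y)
    then have "(y, x) \<in> ?R" "y \<noteq> x" by auto
    then obtain j where
      "j \<noteq> stage ?ws x" "\<iota> x (stage ?ws x) = 0"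
      "\<And>k. \<iota> y k = (if k = j then 0 else if k = stage ?ws x then 1 else \<iota> x k)"
      "j < stage ?ws x \<Longrightarrow> stage ?ws y < j"
      by (rule matching_step_bits[OF emb]) (rule that)
    then show ?case by (rule descends_step)
  next
    case (step z y)
    then have "(z, y) \<in> ?R" "z \<noteq> y" by auto
    then obtain j where
      "j \<noteq> stage ?ws y" "\<iota> y (stage ?ws y) = 0"
      "\<And>k. \<iota> z k = (if k = j then 0 else if k = stage ?ws y then 1 else \<iota> y k)"
      "j < stage ?ws y \<Longrightarrow> stage ?ws z < j"
      by (rule matching_step_bits[OF emb]) (rule that)
    from descends_extend[OF step.IH this] show ?case .
  qed
  have "acyclic (?R - Id)"
    unfolding acyclic_def using path descends_irrefl[of \<iota> "stage ?ws"] by blast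
  then have "antisym ((?R - Id)\<^sup>*)"
    by (rule acyclic_impl_antisym_rtrancl)
  then show "antisym (?R\<^sup>+)"
    unfolding rtrancl_r_diff_Id by (rule antisym_subset[rotated]) (auto intro: trancl_into_rtrancl)
qed

section \<open>Patching acyclic matchings along an order-preserving map\<close>

lemma cells_fiber: "cells (fiber X f p) = {x \<in> cells X. f x = p}"
  by (simp add: fiber_def Let_def)

lemma prec_fiber: "prec (fiber X f p) y x \<longleftrightarrow> prec X y x \<and> f x = p \<and> f y = p"
  by (auto simp: prec_def fiber_def Let_def)

text \<open>Along \<open>\<lless>\<close> the value of \<open>f\<close> cannot increase, so it is constant on a closed path.\<close>

lemma acyclic_partial_matching_patchwork:
  fixes X :: "('a, 'k::field) cell_cx" and f :: "'a \<Rightarrow> 'p::order"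
  assumes X: "cell_complex X" and f: "order_preserving X f"
    and fib: "\<And>p. acyclic_partial_matching (fiber X f p) w"
  shows "acyclic_partial_matching X w"
proof (rule acyclic_partial_matchingI)
  have pm: "partial_matching (fiber X f p) w" for p
    using fib by (simp add: acyclic_partial_matching_def)
  have w_fiber: "w x \<in> cells X" "f (w x) = f x" "w (w x) = x"
    and w_prec: "w x = x \<or> prec X x (w x) \<or> prec X (w x) x" if "x \<in> cells X" for x
    using pm[of "f x"] that by (auto simp: partial_matching_def cells_fiber prec_fiber)
  then show "partial_matching X w" by (auto simp: partial_matching_def)
  have Q: "x \<in> matching_Q (fiber X f (f x)) w" if "x \<in> matching_Q X w" for x
    using that w_fiber(2)[of x] by (auto simp: matching_Q_def prec_fiber cells_fiber)
  have edge: "f y \<le> f x \<and> (f y = f x \<longrightarrow> (y, x) \<in> matching_rel (fiber X f (f x)) w)"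
    if "(y, x) \<in> matching_rel X w" for x y
  proof -
    have x: "x \<in> cells X" "x \<in> matching_Q X w" and y: "y \<in> matching_Q X w"
      and down: "prec X y (w x)"
      using that by (auto simp: matching_rel_def matching_Q_def)
    have "y \<in> cells X" "(y, w x) \<in> face X"
      using X down w_fiber(1)[OF x(1)] by (auto simp: cell_complex_def prec_def)
    then have "f y \<le> f (w x)"
      using f w_fiber(1)[OF x(1)] by (auto simp: order_preserving_def monotone_on_def)
    moreover have "(y, x) \<in> matching_rel (fiber X f (f x)) w" if "f y = f x"
      using that Q[OF x(2)] Q[OF y] down w_fiber(2)[OF x(1)]
      by (simp add: matching_rel_def prec_fiber)
    ultimately show ?thesis using w_fiber(2)[OF x(1)] by simp
  qed
  have path: "f y \<le> f x \<and> (f y = f x \<longrightarrow> (y, x) \<in> (matching_rel (fiber X f (f x)) w)\<^sup>+)"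
    if "(y, x) \<in> (matching_rel X w)\<^sup>+" for x y
    using that
  proof (induction rule: converse_trancl_induct)
    case (base y)
    then show ?case using edge by blast
  next
    case (step z y)
    have zy: "f z \<le> f y" "f z = f y \<Longrightarrow> (z, y) \<in> matching_rel (fiber X f (f y)) w"
      using edge[OF step.hyps(1)] by auto
    show ?case
    proof (intro conjI impI)
      show "f z \<le> f x" using zy(1) step.IH by (auto intro: order.trans)
      assume "f z = f x"
      then have "f z = f y" "f y = f x" using zy step.IH by auto
      then show "(z, x) \<in> (matching_rel (fiber X f (f x)) w)\<^sup>+"
        using zy step.IH by (auto intro: trancl_into_trancl2)
    qed
  qed
  show "antisym ((matching_rel X w)\<^sup>+)"
  proof (rule antisymI)
    fix x y assume xy: "(x, y) \<in> (matching_rel X w)\<^sup>+" "(y, x) \<in> (matching_rel X w)\<^sup>+"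
    then have "f x = f y" using path by (meson order.antisym)
    moreover have "antisym ((matching_rel (fiber X f (f x)) w)\<^sup>+)"
      using fib by (simp add: acyclic_partial_matching_def partial_order_on_def)
    ultimately show "x = y" using path[OF xy(1)] path[OF xy(2)] by (auto dest: antisymD)
  qed
qed

lemma acyclic_partial_matching_cong:
  fixes X :: "('a, 'k::field) cell_cx"
  assumes "\<And>x. x \<in> cells X \<Longrightarrow> w x = w' x" "acyclic_partial_matching X w'"
  shows "acyclic_partial_matching X w"
proof -
  have Q: "matching_Q X w = matching_Q X w'"
    using assms(1) by (auto simp: matching_Q_def)
  have "matching_rel X w = matching_rel X w'"
    unfolding matching_rel_def Q using assms(1) by (auto simp: matching_Q_def)
  moreover have "partial_matching X w"
    using assms by (auto simp: acyclic_partial_matching_def partial_matching_def Pi_iff)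
  ultimately show ?thesis
    using assms(2) Q by (simp add: acyclic_partial_matching_def)
qed

theorem theorem1p3:
  fixes X :: "('a, 'k::field) cell_cx"
    and f :: "'a \<Rightarrow> 'p::order"
    and n :: "'p \<Rightarrow> nat"
    and \<iota> :: "'p \<Rightarrow> 'a \<Rightarrow> (nat \<Rightarrow> bit)"
    and w :: "'a \<Rightarrow> 'a"
  assumes "cell_complex X"
    and "order_preserving X f"
    and "\<And>p. n p \<ge> 1"
    and "\<And>p. incidence_embedding (fiber X f p) (hypercube (n p)) (\<iota> p)"
    and "\<And>p x. x \<in> cells (fiber X f p) \<Longrightarrow>
           w x = mate x (alpha_seq (fiber X f p) (n p) (\<iota> p))"
  shows "acyclic_partial_matching X w"
  using assms(1,2)
proof (rule acyclic_partial_matching_patchwork)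
  show "acyclic_partial_matching (fiber X f p) w" for p
    using assms(5) acyclic_partial_matching_mate_cube[OF assms(4)]
    by (rule acyclic_partial_matching_cong)
qed

end
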